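(* Assume the full setting of the context (standing assumptions (A1)–(A6)). Suppose the policy-dependent state transition matrix $\mathbf A_t=\mathbf A+\mathbf\Delta_t$ is almost surely unstable, i.e. there is a positive constant $\widetilde\zeta>1$ such that (almost surely) $\widetilde\zeta\le\|\mathbf A_t\|\le1-\gamma+\kappa^2\xi_t$ for all $0\le t<T$. Then, in order that the condition $$\sum_{t=0}^{T-1}\Big(\varepsilon_t\sum_{i=t+1}^{T}\nu_i\Big)<\widetilde\mu$$ be satisfied, one must have $$\varepsilon_t<\frac{\overline\phi\,(T-H+1)\,\overline\mu}{\widetilde\zeta^{\,T-t}-1},\qquad\forall\,0\le t<T,$$ where $\overline\mu=\min\left\{\frac{\mu\sigma^2}{2},\frac{\mu\sigma^2\gamma^2}{64\kappa^{10}}\right\}$ and $\overline\phi$ is some positive constant.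
   Context: Notation: $\|\cdot\|$ is the Euclidean norm of vectors and spectral norm of matrices; $\|\cdot\|_F$ is the Frobenius norm. Fix integers $d_x,d_u,T\ge1$ and $1\le H<T$, and matrices $\mathbf A\in\mathbb R^{d_x\times d_x}$, $\mathbf B\in\mathbb R^{d_x\times d_u}$, $\mathbf K\in\mathbb R^{d_u\times d_x}$; put $\widetilde{\mathbf A}=\mathbf A-\mathbf B\mathbf K$. $\mathbf K$ is a $(\kappa,\gamma)$-strongly stabilizing controller for $(\mathbf A,\mathbf B)$: $\kappa\ge1$, $\gamma<1$, $\|\mathbf K\|\le\kappa$, and $\widetilde{\mathbf A}=\mathbf Q\mathbf L\mathbf Q^{-1}$ with $\|\mathbf L\|\le1-\gamma$, $\|\mathbf Q\|,\|\mathbf Q^{-1}\|\le\kappa$. Policies: matrices $\mathbf M=[\mathbf M^{(1)},\dots,\mathbf M^{(H)}]\in\mathbb R^{d_u\times Hd_x}$ in a convex set $\mathbb M$ such that $\|\mathbf M\|_F\le M$ for all $\mathbf M\in\mathbb M$ (italic $M$ is a scalar). Dynamics under policy $\mathbf M$ (disturbance-action policy): $\mathbf x_{t+1}=(\mathbf A+\mathbf\Delta_t)\mathbf x_t+\mathbf B\mathbf u_t+\mathbf w_t$ for $0\le t<T$, $\mathbf u_t=-\mathbf K\mathbf x_t+\mathbf M[\mathbf w]_{t-1}^H$ for $0\le t\le T$, where $[\mathbf w]_{t-1}^H=[\mathbf w_{t-1}^\top,\dots,\mathbf w_{t-H}^\top]^\top$ and $\mathbf w_i=\mathbf 0$ for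 $i<0$. The random initial state satisfies $\|\mathbf x_0\|\le x_0$ ($x_0$ a scalar constant) and is independent of $\{\mathbf\Delta_t\},\{\mathbf w_t\}$. (A1) $\mathbf w_0,\dots,\mathbf w_{T-1}$ are i.i.d., $\mathbb E[\mathbf w_t]=\mathbf 0$, $\mathbb E[\mathbf w_t\mathbf w_t^\top]\succeq\sigma^2\mathbf I$, $\|\mathbf w_t\|\le W$, and $\mathbb E[\mathbf w_{t_1}\mathbf w_{t_2}^\top]=\mathbf 0$ for $t_1\ne t_2$. (A2) $\mathbf\Delta_t\sim\mathcal D_t(\mathbf M)$ (a law depending on the deployed policy $\mathbf M$), $\mathbb E[\mathbf\Delta_t]=\mathbf 0$, $\|\mathbf\Delta_t\|\le\xi_t$ with $\xi_t$ a finite constant, $0\le t<T$; the $\mathbf\Delta_t$ are mutually independent, and $\{\mathbf\Delta_t\}$ and $\{\mathbf w_t\}$ are independent. (A3) For each $0\le t<T$ there is $\varepsilon_t>0$ (the sensitivity) with $\mathcal W^1(\mathcal D_t(\mathbf M),\mathcal D_t(\mathbf M'))\le\varepsilon_t\|\mathbf M-\mathbf M'\|_F$ for all $\mathbf M,\mathbf M'\in\mathbb M$ ($\mathcal W^1$: Wasserstein-1 distance, ground metric the Frobenius norm). (A4) Each cost $c_t:\mathbb R^{d_x}\times\mathbb R^{d_u}\to\mathbb R$, $0\le t\le T$, is differentiable and $\mu$-strongly convex jointly in $(\mathbf x,\mathbf u)$. (A5) $\|\nabla_{\mathbf x}c_t(\mathbf x_1,\mathbf u_1)-\nabla_{\mathbf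 x}c_t(\mathbf x_2,\mathbf u_2)\|+\|\nabla_{\mathbf u}c_t(\mathbf x_1,\mathbf u_1)-\nabla_{\mathbf u}c_t(\mathbf x_2,\mathbf u_2)\|\le\varsigma(\|\mathbf x_1-\mathbf x_2\|+\|\mathbf u_1-\mathbf u_2\|)$ for all arguments. (A6) There is $G>0$ such that $\|\nabla_{\mathbf x}c_t(\mathbf x,\mathbf u)\|,\|\nabla_{\mathbf u}c_t(\mathbf x,\mathbf u)\|\le GD$ whenever $\|\mathbf x\|,\|\mathbf u\|\le D$. Constants (empty products equal 1): $\alpha_t=\prod_{i=0}^{t-1}(1-\gamma+\kappa^2\xi_i)$, $\beta_t=\sum_{i=0}^{t-1}\prod_{j=i+1}^{t-1}(1-\gamma+\kappa^2\xi_j)$, $c_1=d_x\varsigma H^{3/2}W(1+(\kappa^2+\kappa^3)\|\mathbf B\|)(\kappa^2+\kappa^3)(1-\gamma)^{-1}$, $c_2=d_xH^{3/2}WG(1-\gamma)^{-1}(\kappa^4+\kappa^5)\|\mathbf B\|$, $c_3=(HM\|\mathbf B\|+1)W$, $\nu_t=(c_1+c_2\beta_t)(x_0\alpha_t+c_3\beta_t)$ for $1\le t\le T$, and $\widetilde\mu=\min\left\{\frac{(T-H+1)\mu\sigma^2}{2},\frac{(T-H+1)\mu\sigma^2\gamma^2}{64\kappa^{10}}\right\}$. The displayed condition $\sum_{t=0}^{T-1}(\varepsilon_t\sum_{i=t+1}^T\nu_i)<\widetilde\mu$ is the one used as a sufficient condition for existence and uniqueness of a performatively stable policy, i.e. a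 fixed point of the map sending $\mathbf M'$ to the minimizer over $\mathbf M\in\mathbb M$ of $\mathbb E[\sum_{t=0}^Tc_t(\mathbf x_t,\mathbf u_t)]$, where the trajectory uses policy $\mathbf M$ and $\mathbf\Delta_t\sim\mathcal D_t(\mathbf M')$. *)

theory Defs
  imports "HOL-Probability.Probability"
begin

text \<open>
  The norm that the library puts on \<open>real ^ 'n ^ 'm\<close> is the Frobenius norm, so \<open>norm\<close> and
  \<open>dist\<close> on matrices are used for it below; the spectral norm is the operator norm.
\<close>

definition spectral_norm :: "real ^ 'n ^ 'm \<Rightarrow> real" where
  "spectral_norm X = onorm ((*v) X)"

definition outer :: "real ^ 'm \<Rightarrow> real ^ 'n \<Rightarrow> real ^ 'n ^ 'm" where
  "outer v w = (\<chi> i j. v $ i * w $ j)"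

definition psd :: "real ^ 'n ^ 'n \<Rightarrow> bool" where
  "psd X \<longleftrightarrow> transpose X = X \<and> (\<forall>v. 0 \<le> v \<bullet> (X *v v))"

definition loewner_le :: "real ^ 'n ^ 'n \<Rightarrow> real ^ 'n ^ 'n \<Rightarrow> bool" where
  "loewner_le X Y \<longleftrightarrow> psd (Y - X)"

definition gradient :: "('a::real_inner \<Rightarrow> real) \<Rightarrow> 'a \<Rightarrow> 'a" where
  "gradient f x = (THE D. GDERIV f x :> D)"

definition strongly_convex :: "real \<Rightarrow> ('a::real_normed_vector \<Rightarrow> real) \<Rightarrow> bool" where
  "strongly_convex \<mu> f \<longleftrightarrow> \<mu> > 0 \<and>
     (\<forall>x y. \<forall>s\<in>{0..1}. f (s *\<^sub>R x + (1 - s) *\<^sub>R y)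
        \<le> s * f x + (1 - s) * f y - \<mu> / 2 * s * (1 - s) * (norm (x - y))\<^sup>2)"

text \<open>
  The library's \<open>indep_var\<close> needs both random variables to take values in the same type;
  \<open>indep_rv\<close> is the same notion for two value types (compare \<open>indep_var_eq\<close>).
\<close>

definition (in prob_space) indep_rv ::
  "'b measure \<Rightarrow> ('a \<Rightarrow> 'b) \<Rightarrow> 'c measure \<Rightarrow> ('a \<Rightarrow> 'c) \<Rightarrow> bool" where
  "indep_rv S X T Y \<longleftrightarrow> random_variable S X \<and> random_variable T Y \<and>
     indep_set {X -` E \<inter> space M | E. E \<in> sets S} {Y -` E \<inter> space M | E. E \<in> sets T}"

definition couplings ::
  "'a::{metric_space, second_countable_topology} measure \<Rightarrow> 'a measure \<Rightarrow> ('a \<times> 'a) measure set" where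
  "couplings P Q = {C. sets C = sets (borel :: ('a \<times> 'a) measure) \<and>
                       distr C borel fst = P \<and> distr C borel snd = Q}"

definition wasserstein1 ::
  "'a::{metric_space, second_countable_topology} measure \<Rightarrow> 'a measure \<Rightarrow> ennreal" where
  "wasserstein1 P Q = (INF C\<in>couplings P Q. \<integral>\<^sup>+ z. ennreal (dist (fst z) (snd z)) \<partial>C)"

definition strongly_stabilizing ::
  "real \<Rightarrow> real \<Rightarrow> real ^ 'x ^ 'x \<Rightarrow> real ^ 'u ^ 'x \<Rightarrow> real ^ 'x ^ 'u \<Rightarrow> bool" where
  "strongly_stabilizing \<kappa> \<gamma> A B K \<longleftrightarrow>
     \<kappa> \<ge> 1 \<and> \<gamma> < 1 \<and> spectral_norm K \<le> \<kappa> \<and>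
     (\<exists>(Q :: real ^ 'x ^ 'x) L. invertible Q \<and> A - B ** K = Q ** L ** matrix_inv Q \<and>
        spectral_norm L \<le> 1 - \<gamma> \<and> spectral_norm Q \<le> \<kappa> \<and> spectral_norm (matrix_inv Q) \<le> \<kappa>)"

text \<open>
  The memory length \<open>H\<close> is \<open>CARD('h)\<close> for a finite linearly ordered index type; \<open>lag\<close> is the
  increasing bijection from \<open>'h\<close> onto \<open>{1..H}\<close>.  A policy is a matrix of type
  \<open>real ^ ('h \<times> 'x) ^ 'u\<close>, whose column \<open>(h, j)\<close> is column \<open>j\<close> of block number \<open>lag h\<close>.
  In \<open>noise_history w t\<close>, block \<open>lag h\<close> is \<open>w\<close> at time \<open>t - lag h\<close>, i.e. it is the stacked
  vector of the disturbances at times \<open>t - 1, \<dots>, t - H\<close>.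
\<close>

definition lag :: "'h::{finite, linorder} \<Rightarrow> nat" where
  "lag h = card {..h}"

definition noise_history ::
  "(nat \<Rightarrow> real ^ 'x) \<Rightarrow> nat \<Rightarrow> real ^ ('h::{finite, linorder} \<times> 'x)" where
  "noise_history w t = (\<chi> p. if lag (fst p) \<le> t then w (t - lag (fst p)) $ snd p else 0)"

text \<open>
  One policy \<open>Pol\<close> is deployed; \<open>\<Delta>\<close>, \<open>X\<close> and \<open>U\<close> are the perturbations, states and controls
  that it generates.  \<open>D t P\<close> is the law of the perturbation at time \<open>t\<close> under policy \<open>P\<close>.
  \<open>Pols\<close> is the policy set, \<open>Mb\<close> its Frobenius bound, \<open>xb\<close> the bound on the initial state,
  \<open>\<theta>\<close> the Lipschitz constant of the cost gradients.  Bounds on random quantities are almost sure.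
\<close>

locale performative_control = prob_space \<Omega>
  for \<Omega> :: "'w measure" +
  fixes A :: "real ^ 'x ^ 'x" and B :: "real ^ 'u ^ 'x" and K :: "real ^ 'x ^ 'u"
    and \<kappa> \<gamma> :: real
    and Pols :: "(real ^ ('h::{finite, linorder} \<times> 'x) ^ 'u) set" and Mb xb W \<theta> G :: real
    and T :: nat and \<sigma> \<mu> :: real and \<xi> \<epsilon> :: "nat \<Rightarrow> real"
    and D :: "nat \<Rightarrow> real ^ ('h \<times> 'x) ^ 'u \<Rightarrow> (real ^ 'x ^ 'x) measure"
    and c :: "nat \<Rightarrow> real ^ 'x \<Rightarrow> real ^ 'u \<Rightarrow> real"
    and Pol :: "real ^ ('h \<times> 'x) ^ 'u"
    and w :: "nat \<Rightarrow> 'w \<Rightarrow> real ^ 'x"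
    and \<Delta> :: "nat \<Rightarrow> 'w \<Rightarrow> real ^ 'x ^ 'x"
    and X :: "nat \<Rightarrow> 'w \<Rightarrow> real ^ 'x"
    and U :: "nat \<Rightarrow> 'w \<Rightarrow> real ^ 'u"
  assumes horizon: "CARD('h) < T"
    and stabilizing: "strongly_stabilizing \<kappa> \<gamma> A B K"
    and policies_convex: "convex Pols"
    and policies_bounded: "\<And>P. P \<in> Pols \<Longrightarrow> norm P \<le> Mb"
    and deployed: "Pol \<in> Pols"
  \<comment> \<open>dynamics\<close>
    and state: "\<And>t \<omega>. t < T \<Longrightarrow> \<omega> \<in> space \<Omega> \<Longrightarrow>
          X (Suc t) \<omega> = (A + \<Delta> t \<omega>) *v X t \<omega> + B *v U t \<omega> + w t \<omega>"
    and control: "\<And>t \<omega>. t \<le> T \<Longrightarrow> \<omega> \<in> space \<Omega> \<Longrightarrow>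
          U t \<omega> = - (K *v X t \<omega>) + Pol *v noise_history (\<lambda>s. w s \<omega>) t"
    and initial_bounded: "AE \<omega> in \<Omega>. norm (X 0 \<omega>) \<le> xb"
    and initial_indep:
          "indep_rv borel (X 0)
             ((\<Pi>\<^sub>M t\<in>{..<T}. borel) \<Otimes>\<^sub>M (\<Pi>\<^sub>M t\<in>{..<T}. borel))
             (\<lambda>\<omega>. (\<lambda>t\<in>{..<T}. \<Delta> t \<omega>, \<lambda>t\<in>{..<T}. w t \<omega>))"
  \<comment> \<open>disturbances\<close>
    and noise_indep: "indep_vars (\<lambda>_. borel) w {..<T}"
    and noise_ident: "\<And>t. t < T \<Longrightarrow> distr \<Omega> borel (w t) = distr \<Omega> borel (w 0)"
    and noise_mean: "\<And>t. t < T \<Longrightarrow> expectation (w t) = 0"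
    and noise_cov: "\<And>t. t < T \<Longrightarrow>
          loewner_le (\<sigma>\<^sup>2 *\<^sub>R mat 1) (expectation (\<lambda>\<omega>. outer (w t \<omega>) (w t \<omega>)))"
    and noise_bounded: "\<And>t. t < T \<Longrightarrow> AE \<omega> in \<Omega>. norm (w t \<omega>) \<le> W"
    and noise_uncorrelated: "\<And>s t. s < T \<Longrightarrow> t < T \<Longrightarrow> s \<noteq> t \<Longrightarrow>
          expectation (\<lambda>\<omega>. outer (w s \<omega>) (w t \<omega>)) = 0"
  \<comment> \<open>policy-dependent perturbations\<close>
    and law_prob: "\<And>t P. t < T \<Longrightarrow> P \<in> Pols \<Longrightarrow> prob_space (D t P)"
    and law_sets: "\<And>t P. t < T \<Longrightarrow> P \<in> Pols \<Longrightarrow> sets (D t P) = sets borel"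
    and law_mean: "\<And>t P. t < T \<Longrightarrow> P \<in> Pols \<Longrightarrow> (LINT Y|D t P. Y) = 0"
    and law_bounded: "\<And>t P. t < T \<Longrightarrow> P \<in> Pols \<Longrightarrow> AE Y in D t P. spectral_norm Y \<le> \<xi> t"
    and perturbation_law: "\<And>t. t < T \<Longrightarrow> distr \<Omega> borel (\<Delta> t) = D t Pol"
    and perturbation_indep: "indep_vars (\<lambda>_. borel) \<Delta> {..<T}"
    and perturbation_noise_indep:
          "indep_rv (\<Pi>\<^sub>M t\<in>{..<T}. borel) (\<lambda>\<omega>. \<lambda>t\<in>{..<T}. \<Delta> t \<omega>)
                    (\<Pi>\<^sub>M t\<in>{..<T}. borel) (\<lambda>\<omega>. \<lambda>t\<in>{..<T}. w t \<omega>)"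
  \<comment> \<open>sensitivity\<close>
    and sensitivity_pos: "\<And>t. t < T \<Longrightarrow> \<epsilon> t > 0"
    and sensitivity: "\<And>t P P'. t < T \<Longrightarrow> P \<in> Pols \<Longrightarrow> P' \<in> Pols \<Longrightarrow>
          wasserstein1 (D t P) (D t P') \<le> ennreal (\<epsilon> t * norm (P - P'))"
  \<comment> \<open>costs\<close>
    and cost_differentiable: "\<And>t z. t \<le> T \<Longrightarrow> (\<lambda>(x, u). c t x u) differentiable (at z)"
    and cost_strongly_convex: "\<And>t. t \<le> T \<Longrightarrow> strongly_convex \<mu> (\<lambda>(x, u). c t x u)"
    and cost_smooth: "\<And>t x1 u1 x2 u2. t \<le> T \<Longrightarrow>
          norm (gradient (\<lambda>x. c t x u1) x1 - gradient (\<lambda>x. c t x u2) x2) +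
          norm (gradient (\<lambda>u. c t x1 u) u1 - gradient (\<lambda>u. c t x2 u) u2)
            \<le> \<theta> * (norm (x1 - x2) + norm (u1 - u2))"
    and G_pos: "G > 0"
    and cost_gradient_bounded: "\<And>t x u R. t \<le> T \<Longrightarrow> norm x \<le> R \<Longrightarrow> norm u \<le> R \<Longrightarrow>
          norm (gradient (\<lambda>x. c t x u) x) \<le> G * R \<and> norm (gradient (\<lambda>u. c t x u) u) \<le> G * R"

text \<open>In the constants below, \<open>b\<close> stands for the spectral norm of \<open>B\<close>.\<close>

definition alpha :: "real \<Rightarrow> real \<Rightarrow> (nat \<Rightarrow> real) \<Rightarrow> nat \<Rightarrow> real" where
  "alpha \<kappa> \<gamma> \<xi> t = (\<Prod>i<t. 1 - \<gamma> + \<kappa>\<^sup>2 * \<xi> i)"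

definition beta :: "real \<Rightarrow> real \<Rightarrow> (nat \<Rightarrow> real) \<Rightarrow> nat \<Rightarrow> real" where
  "beta \<kappa> \<gamma> \<xi> t = (\<Sum>i<t. \<Prod>j=i+1..<t. 1 - \<gamma> + \<kappa>\<^sup>2 * \<xi> j)"

definition const1 :: "nat \<Rightarrow> nat \<Rightarrow> real \<Rightarrow> real \<Rightarrow> real \<Rightarrow> real \<Rightarrow> real \<Rightarrow> real" where
  "const1 dx H \<kappa> \<gamma> b W \<theta> =
     real dx * \<theta> * real H powr (3/2) * W * (1 + (\<kappa>^2 + \<kappa>^3) * b) * (\<kappa>^2 + \<kappa>^3) / (1 - \<gamma>)"

definition const2 :: "nat \<Rightarrow> nat \<Rightarrow> real \<Rightarrow> real \<Rightarrow> real \<Rightarrow> real \<Rightarrow> real \<Rightarrow> real" where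
  "const2 dx H \<kappa> \<gamma> b W G =
     real dx * real H powr (3/2) * W * G / (1 - \<gamma>) * (\<kappa>^4 + \<kappa>^5) * b"

definition const3 :: "nat \<Rightarrow> real \<Rightarrow> real \<Rightarrow> real \<Rightarrow> real" where
  "const3 H b Mb W = (real H * Mb * b + 1) * W"

definition nu :: "nat \<Rightarrow> nat \<Rightarrow> real \<Rightarrow> real \<Rightarrow> real \<Rightarrow> real \<Rightarrow> real \<Rightarrow> real \<Rightarrow> real \<Rightarrow> real
    \<Rightarrow> (nat \<Rightarrow> real) \<Rightarrow> nat \<Rightarrow> real" where
  "nu dx H \<kappa> \<gamma> b Mb xb W \<theta> G \<xi> t =
     (const1 dx H \<kappa> \<gamma> b W \<theta> + const2 dx H \<kappa> \<gamma> b W G * beta \<kappa> \<gamma> \<xi> t) *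
     (xb * alpha \<kappa> \<gamma> \<xi> t + const3 H b Mb W * beta \<kappa> \<gamma> \<xi> t)"

definition mu_tilde :: "nat \<Rightarrow> nat \<Rightarrow> real \<Rightarrow> real \<Rightarrow> real \<Rightarrow> real \<Rightarrow> real" where
  "mu_tilde H T \<kappa> \<gamma> \<mu> \<sigma> =
     min ((real T - real H + 1) * \<mu> * \<sigma>\<^sup>2 / 2)
         ((real T - real H + 1) * \<mu> * \<sigma>\<^sup>2 * \<gamma>\<^sup>2 / (64 * \<kappa>^10))"

definition mu_bar :: "real \<Rightarrow> real \<Rightarrow> real \<Rightarrow> real \<Rightarrow> real" where
  "mu_bar \<kappa> \<gamma> \<mu> \<sigma> = min (\<mu> * \<sigma>\<^sup>2 / 2) (\<mu> * \<sigma>\<^sup>2 * \<gamma>\<^sup>2 / (64 * \<kappa>^10))"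

end

theory Submission
  imports Defs
begin

text \<open>
  In the unstable regime every factor \<open>1 - \<gamma> + \<kappa>\<^sup>2 * \<xi> t\<close> is at least \<open>\<zeta> > 1\<close>, so already the
  oldest disturbance contributes \<open>\<zeta> ^ (T - 1)\<close> to \<open>beta T\<close> (\<open>power_le_beta\<close>).  All other
  ingredients of \<open>nu\<close> are nonnegative, hence \<open>nu T \<ge> c\<^sub>1 * c\<^sub>3 * \<zeta> ^ (T - 1)\<close>
  (\<open>const_mult_power_le_nu\<close>).  The left-hand side of the stability condition
  is a sum of nonnegative terms that includes \<open>\<epsilon> t * nu T\<close>; its right-hand side is
  \<open>(T - H + 1) * mu_bar\<close>.  Since \<open>\<zeta> ^ (T - t) - 1 \<le> \<zeta> * \<zeta> ^ (T - 1)\<close>, the claim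
  follows with \<open>\<phi> = \<zeta> / (c\<^sub>1 * c\<^sub>3)\<close>, which depends neither on the horizon nor on the laws
  of the perturbations.

  This choice of \<open>\<phi>\<close> needs \<open>c\<^sub>1\<close> and \<open>c\<^sub>3\<close> to be positive, which amounts to \<open>\<theta> > 0\<close> and
  \<open>W > 0\<close>.  Strong convexity forces the Lipschitz constant of the gradients to satisfy
  \<open>\<theta> \<ge> \<mu> > 0\<close> (\<open>smoothness_ge_convexity\<close>).  The noise bound is positive
  unless \<open>\<sigma> = 0\<close> (\<open>noise_bound_pos\<close>), and for \<open>\<sigma> = 0\<close> the condition reads
  \<open>0 \<le> \<dots> < 0\<close> and cannot hold.
\<close>

section \<open>Strongly convex functions\<close>

lemma gderiv_unique:
  assumes "GDERIV f x :> D" "GDERIV f x :> D'"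
  shows "D = D'"
proof -
  have "(\<lambda>h. h \<bullet> D) = (\<lambda>h. h \<bullet> D')"
    using assms unfolding gderiv_def by (rule has_derivative_unique)
  then have "(D - D') \<bullet> D = (D - D') \<bullet> D'"
    by meson
  then have "(D - D') \<bullet> (D - D') = 0"
    by (simp add: inner_diff_right)
  then show ?thesis
    by simp
qed

lemma gradient_eq: "GDERIV f x :> D \<Longrightarrow> gradient f x = D"
  unfolding gradient_def by (blast intro: gderiv_unique)

lemma has_gderiv_gradient:
  fixes f :: "'a::euclidean_space \<Rightarrow> real"
  assumes "f differentiable (at x)"
  shows "GDERIV f x :> gradient f x"
proof -
  obtain f' where f': "(f has_derivative f') (at x)"
    using assms unfolding differentiable_def by blast
  then interpret linear f'
    by (rule has_derivative_linear)
  define D where "D = (\<Sum>b\<in>Basis. f' b *\<^sub>R b)"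
  have "f' h = h \<bullet> D" for h
  proof -
    have "f' h = f' (\<Sum>b\<in>Basis. (h \<bullet> b) *\<^sub>R b)"
      by (simp add: euclidean_representation)
    also have "\<dots> = h \<bullet> D"
      by (simp only: D_def sum scale inner_sum_right inner_scaleR_right real_scaleR_def mult.commute)
    finally show ?thesis .
  qed
  then have "GDERIV f x :> D"
    using f' unfolding gderiv_def by presburger
  then show ?thesis
    by (simp add: gradient_eq)
qed

text \<open>
  The strong convexity inequality on the segment from \<open>x\<close> to \<open>y\<close> bounds the difference quotient
  of \<open>f\<close> at \<open>x\<close> in direction \<open>y - x\<close>; letting the step tend to \<open>0\<close> bounds the directional
  derivative.
\<close>

lemma strongly_convex_first_order:
  assumes sc: "strongly_convex \<mu> f" and D: "GDERIV f x :> D"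
  shows "(y - x) \<bullet> D \<le> f y - f x - \<mu> / 2 * (norm (y - x))\<^sup>2"
proof -
  define g where "g s = f (x + s *\<^sub>R (y - x))" for s
  have "(g has_derivative (\<lambda>s. (s *\<^sub>R (y - x)) \<bullet> D)) (at 0)"
  proof -
    have "((\<lambda>s. x + s *\<^sub>R (y - x)) has_derivative (\<lambda>s. s *\<^sub>R (y - x))) (at 0)"
      by (auto intro!: derivative_eq_intros)
    moreover have "(f has_derivative (\<lambda>h. h \<bullet> D)) (at (x + 0 *\<^sub>R (y - x)))"
      using D by (simp add: gderiv_def)
    ultimately show ?thesis
      unfolding g_def by (rule has_derivative_compose)
  qed
  then have "(g has_real_derivative (y - x) \<bullet> D) (at 0)"
    by (simp add: has_field_derivative_def mult_commute_abs)
  then have "((\<lambda>h. (g h - g 0) / h) \<longlongrightarrow> (y - x) \<bullet> D) (at_right 0)"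
    unfolding DERIV_def by (auto intro: tendsto_within_subset)
  moreover have "((\<lambda>h. f y - f x - \<mu> / 2 * (1 - h) * (norm (y - x))\<^sup>2)
      \<longlongrightarrow> f y - f x - \<mu> / 2 * (1 - 0) * (norm (y - x))\<^sup>2) (at_right (0::real))"
    by (intro tendsto_intros)
  moreover have "(g h - g 0) / h \<le> f y - f x - \<mu> / 2 * (1 - h) * (norm (y - x))\<^sup>2"
    if "0 < h" "h < 1" for h
  proof -
    have "f (h *\<^sub>R y + (1 - h) *\<^sub>R x)
        \<le> h * f y + (1 - h) * f x - \<mu> / 2 * h * (1 - h) * (norm (y - x))\<^sup>2"
      using sc that unfolding strongly_convex_def by auto
    moreover have "h *\<^sub>R y + (1 - h) *\<^sub>R x = x + h *\<^sub>R (y - x)"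
      by (simp add: algebra_simps)
    ultimately have "g h - g 0 \<le> (f y - f x - \<mu> / 2 * (1 - h) * (norm (y - x))\<^sup>2) * h"
      by (simp add: g_def algebra_simps)
    with that show ?thesis
      by (simp add: pos_divide_le_eq)
  qed
  then have "\<forall>\<^sub>F h in at_right 0.
      (g h - g 0) / h \<le> f y - f x - \<mu> / 2 * (1 - h) * (norm (y - x))\<^sup>2"
    by (auto simp: eventually_at_right_field intro!: exI[of _ 1])
  ultimately have "(y - x) \<bullet> D \<le> f y - f x - \<mu> / 2 * (1 - 0) * (norm (y - x))\<^sup>2"
    by (intro tendsto_le[OF trivial_limit_at_right_real])
  then show ?thesis
    by simp
qed

text \<open>Adding the first-order inequalities at \<open>x\<close> and at \<open>y\<close> cancels the values of \<open>f\<close>.\<close>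

lemma strongly_convex_gradient_expanding:
  assumes sc: "strongly_convex \<mu> f"
    and Dx: "GDERIV f x :> Dx" and Dy: "GDERIV f y :> Dy"
  shows "\<mu> * norm (x - y) \<le> norm (Dx - Dy)"
proof (cases "x = y")
  case False
  have "\<mu> * (norm (x - y))\<^sup>2 \<le> (x - y) \<bullet> (Dx - Dy)"
    using strongly_convex_first_order[OF sc Dx, of y] strongly_convex_first_order[OF sc Dy, of x]
    by (simp add: inner_diff_left inner_diff_right norm_minus_commute)
  also have "\<dots> \<le> norm (x - y) * norm (Dx - Dy)"
    by (rule norm_cauchy_schwarz)
  finally have "norm (x - y) * (\<mu> * norm (x - y)) \<le> norm (x - y) * norm (Dx - Dy)"
    by (simp add: power2_eq_square mult.left_commute)
  with False show ?thesis
    by simp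
qed simp

section \<open>Consequences of the standing assumptions\<close>

lemma spectral_norm_nonneg: "0 \<le> spectral_norm X"
  unfolding spectral_norm_def by (simp add: onorm_pos_le)

text \<open>An event of probability one is nonempty, so the bound holds at some outcome.\<close>

lemma (in prob_space) AE_norm_bound_nonneg:
  assumes "AE \<omega> in M. norm (Y \<omega>) \<le> r"
  shows "0 \<le> r"
proof -
  obtain \<omega> where "norm (Y \<omega>) \<le> r"
    using eventually_happens'[OF ae_filter_bot assms] by blast
  then show ?thesis
    using norm_ge_zero order_trans by blast
qed

context performative_control
begin

text \<open>Only the state is varied: freezing the control keeps strong convexity, and the
  gradient in the state can then grow neither slower than \<open>\<mu>\<close> nor faster than \<open>\<theta>\<close>.\<close>

lemma smoothness_ge_convexity: "\<mu> \<le> \<theta>"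
proof -
  define f where "f x = c 0 x 0" for x
  have sc: "strongly_convex \<mu> f"
    unfolding strongly_convex_def
  proof (intro conjI allI ballI)
    show "0 < \<mu>"
      using cost_strongly_convex[of 0] by (simp add: strongly_convex_def)
  next
    fix x y :: "real ^ 'x" and s :: real
    assume "s \<in> {0..1}"
    then have "(\<lambda>(x, u). c 0 x u) (s *\<^sub>R (x, 0) + (1 - s) *\<^sub>R (y, 0))
        \<le> s * (\<lambda>(x, u). c 0 x u) (x, 0) + (1 - s) * (\<lambda>(x, u). c 0 x u) (y, 0)
          - \<mu> / 2 * s * (1 - s) * (norm ((x, 0 :: real ^ 'u) - (y, 0)))\<^sup>2"
      using cost_strongly_convex[of 0] unfolding strongly_convex_def by blast
    then show "f (s *\<^sub>R x + (1 - s) *\<^sub>R y)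
        \<le> s * f x + (1 - s) * f y - \<mu> / 2 * s * (1 - s) * (norm (x - y))\<^sup>2"
      by (simp add: f_def norm_Pair)
  qed
  have "f differentiable (at x)" for x
  proof -
    have "(\<lambda>x. (x, 0)) differentiable (at x)"
      by (auto intro!: differentiableI derivative_eq_intros)
    then have "((\<lambda>(x, u). c 0 x u) \<circ> (\<lambda>x. (x, 0))) differentiable (at x)"
      using cost_differentiable[of 0] by (auto intro: differentiable_chain_at)
    then show ?thesis
      by (simp add: f_def[abs_def] comp_def)
  qed
  then have grad: "GDERIV f x :> gradient f x" for x
    by (rule has_gderiv_gradient)
  obtain e :: "real ^ 'x" where e: "norm e = 1"
    using vector_choose_size[of 1] by auto
  have "\<mu> * norm (e - 0) \<le> norm (gradient f e - gradient f 0)"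
    by (rule strongly_convex_gradient_expanding[OF sc grad grad])
  also have "\<dots> \<le> \<theta> * (norm (e - 0) + norm (0 - 0 :: real ^ 'u))"
    using cost_smooth[of 0 0 e 0 0]
      norm_ge_zero[of "gradient (\<lambda>u. c 0 e u) 0 - gradient (\<lambda>u. c 0 0 u) 0"]
    unfolding f_def[abs_def] by linarith
  finally show ?thesis
    using e by simp
qed

lemma smoothness_pos: "0 < \<theta>"
  using smoothness_ge_convexity cost_strongly_convex[of 0] by (simp add: strongly_convex_def)

lemma initial_bound_nonneg: "0 \<le> xb"
  using initial_bounded by (rule AE_norm_bound_nonneg)

lemma noise_bound_nonneg: "0 \<le> W"
  using horizon by (intro AE_norm_bound_nonneg[OF noise_bounded[of 0]]) simp

lemma policy_bound_nonneg: "0 \<le> Mb"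
  using policies_bounded[OF deployed] norm_ge_zero order_trans by blast

text \<open>If \<open>W = 0\<close>, then the noise vanishes almost surely, and so does its second moment, which
  dominates \<open>\<sigma>\<^sup>2\<close> times the identity.\<close>

lemma noise_bound_pos:
  assumes "\<sigma> \<noteq> 0"
  shows "0 < W"
proof (rule ccontr)
  assume "\<not> 0 < W"
  with noise_bound_nonneg have "W = 0"
    by simp
  have "0 < T"
    using horizon by simp
  then have "AE \<omega> in \<Omega>. w 0 \<omega> = 0"
    using noise_bounded[of 0] \<open>W = 0\<close> by simp
  then have "AE \<omega> in \<Omega>. outer (w 0 \<omega>) (w 0 \<omega>) = 0"
    by eventually_elim (simp add: outer_def vec_eq_iff)
  then have "expectation (\<lambda>\<omega>. outer (w 0 \<omega>) (w 0 \<omega>)) = 0"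
    by (rule integral_eq_zero_AE)
  with noise_cov[OF \<open>0 < T\<close>] have psd: "psd (- (\<sigma>\<^sup>2 *\<^sub>R mat 1 :: real ^ 'x ^ 'x))"
    by (simp add: loewner_le_def)
  obtain e :: "real ^ 'x" where "norm e = 1"
    using vector_choose_size[of 1] by auto
  moreover have "- (\<sigma>\<^sup>2 *\<^sub>R mat 1) *v e = - (\<sigma>\<^sup>2 *\<^sub>R e)"
    using matrix_vector_mult_diff_rdistrib[of 0 "\<sigma>\<^sup>2 *\<^sub>R mat 1" e]
    by (simp add: scaleR_matrix_vector_assoc[symmetric])
  ultimately have "e \<bullet> (- (\<sigma>\<^sup>2 *\<^sub>R mat 1) *v e) = - \<sigma>\<^sup>2"
    by (simp add: dot_square_norm)
  moreover have "0 \<le> e \<bullet> (- (\<sigma>\<^sup>2 *\<^sub>R mat 1) *v e)"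
    using psd unfolding psd_def by blast
  ultimately have "0 \<le> - \<sigma>\<^sup>2"
    by simp
  with assms show False
    by simp
qed

end

section \<open>Growth of the constants in the unstable regime\<close>

lemma alpha_nonneg:
  assumes "\<And>j. j < t \<Longrightarrow> 0 \<le> 1 - \<gamma> + \<kappa>\<^sup>2 * \<xi> j"
  shows "0 \<le> alpha \<kappa> \<gamma> \<xi> t"
  unfolding alpha_def by (rule prod_nonneg) (use assms in auto)

lemma beta_nonneg:
  assumes "\<And>j. j < t \<Longrightarrow> 0 \<le> 1 - \<gamma> + \<kappa>\<^sup>2 * \<xi> j"
  shows "0 \<le> beta \<kappa> \<gamma> \<xi> t"
  unfolding beta_def by (intro sum_nonneg prod_nonneg) (use assms in auto)

lemma power_le_beta:
  assumes \<zeta>: "0 \<le> \<zeta>" and unst: "\<And>j. j < t \<Longrightarrow> \<zeta> \<le> 1 - \<gamma> + \<kappa>\<^sup>2 * \<xi> j" and "0 < t"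
  shows "\<zeta> ^ (t - 1) \<le> beta \<kappa> \<gamma> \<xi> t"
proof -
  (* the bounds 0+1..<t match the summand i = 0 of beta *)
  have "\<zeta> ^ (t - 1) = (\<Prod>j=0+1..<t. \<zeta>)"
    by simp
  also have "\<dots> \<le> (\<Prod>j=0+1..<t. 1 - \<gamma> + \<kappa>\<^sup>2 * \<xi> j)"
    by (rule prod_mono) (use \<zeta> unst in auto)
  also have "\<dots> \<le> beta \<kappa> \<gamma> \<xi> t"
    unfolding beta_def
  proof (rule member_le_sum)
    fix i assume "i \<in> {..<t} - {0}"
    show "0 \<le> (\<Prod>j=i+1..<t. 1 - \<gamma> + \<kappa>\<^sup>2 * \<xi> j)"
      by (rule prod_nonneg) (use \<zeta> unst in \<open>force intro: order_trans\<close>)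
  qed (use \<open>0 < t\<close> in auto)
  finally show ?thesis .
qed

lemma mu_tilde_eq:
  assumes "H \<le> T"
  shows "mu_tilde H T \<kappa> \<gamma> \<mu> \<sigma> = (real T - real H + 1) * mu_bar \<kappa> \<gamma> \<mu> \<sigma>"
  using assms unfolding mu_tilde_def mu_bar_def by (simp add: min_mult_distrib_left mult.assoc)

text \<open>Of the two growing factors of \<open>nu\<close> only \<open>const3 * beta\<close> is exploited: the growth of the
  first one is lost if \<open>B = 0\<close>, where \<open>const2\<close> vanishes, and that of \<open>xb * alpha\<close> if the initial
  state is \<open>0\<close>.\<close>

lemma const_mult_power_le_nu:
  assumes c: "0 \<le> const1 dx H \<kappa> \<gamma> b W \<theta>" "0 \<le> const2 dx H \<kappa> \<gamma> b W G" "0 \<le> const3 H b Mb W"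
    and "0 \<le> xb" and \<zeta>: "0 \<le> \<zeta>"
    and unst: "\<And>j. j < t \<Longrightarrow> \<zeta> \<le> 1 - \<gamma> + \<kappa>\<^sup>2 * \<xi> j" and "0 < t"
  shows "const1 dx H \<kappa> \<gamma> b W \<theta> * const3 H b Mb W * \<zeta> ^ (t - 1)
    \<le> nu dx H \<kappa> \<gamma> b Mb xb W \<theta> G \<xi> t"
proof -
  have nonneg: "\<And>j. j < t \<Longrightarrow> 0 \<le> 1 - \<gamma> + \<kappa>\<^sup>2 * \<xi> j"
    using \<zeta> unst by (meson order_trans)
  have \<alpha>: "0 \<le> xb * alpha \<kappa> \<gamma> \<xi> t"
    using \<open>0 \<le> xb\<close> alpha_nonneg[OF nonneg] by simp
  have \<beta>: "\<zeta> ^ (t - 1) \<le> beta \<kappa> \<gamma> \<xi> t"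
    using \<zeta> unst \<open>0 < t\<close> by (rule power_le_beta)
  have "const1 dx H \<kappa> \<gamma> b W \<theta> * (const3 H b Mb W * \<zeta> ^ (t - 1))
      \<le> nu dx H \<kappa> \<gamma> b Mb xb W \<theta> G \<xi> t"
    unfolding nu_def
  proof (rule mult_mono)
    show "const1 dx H \<kappa> \<gamma> b W \<theta>
        \<le> const1 dx H \<kappa> \<gamma> b W \<theta> + const2 dx H \<kappa> \<gamma> b W G * beta \<kappa> \<gamma> \<xi> t"
      using c beta_nonneg[OF nonneg] by simp
    show "const3 H b Mb W * \<zeta> ^ (t - 1)
        \<le> xb * alpha \<kappa> \<gamma> \<xi> t + const3 H b Mb W * beta \<kappa> \<gamma> \<xi> t"
      using mult_left_mono[OF \<beta> c(3)] \<alpha> by simp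
  qed (use c \<zeta> beta_nonneg[OF nonneg] in auto)
  then show ?thesis
    by (simp add: mult.assoc)
qed

section \<open>Necessary size of the sensitivities\<close>

text \<open>The witness has to be fixed before any control problem is given, hence before the positivity
  of \<open>c\<^sub>1 * c\<^sub>3\<close> is known.  If this product is not positive, no control problem satisfies
  the hypotheses, and any positive number serves as \<open>\<phi>\<close>.\<close>

theorem proposition2:
  fixes A :: "real ^ 'x ^ 'x" and B :: "real ^ 'u ^ 'x" and K :: "real ^ 'x ^ 'u"
    and Pols :: "(real ^ ('h::{finite, linorder} \<times> 'x) ^ 'u) set"
    and \<kappa> \<gamma> Mb xb W \<theta> G \<zeta> :: real
  assumes "\<zeta> > 1"
  shows "\<exists>\<phi>>0. \<forall>(\<Omega> :: 'w measure) T \<sigma> \<mu> \<xi> \<epsilon> D c Pol w \<Delta> X U.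
     performative_control \<Omega> A B K \<kappa> \<gamma> Pols Mb xb W \<theta> G T \<sigma> \<mu> \<xi> \<epsilon> D c Pol w \<Delta> X U \<longrightarrow>
     (AE \<omega> in \<Omega>. \<forall>t<T. \<zeta> \<le> spectral_norm (A + \<Delta> t \<omega>) \<and>
        spectral_norm (A + \<Delta> t \<omega>) \<le> 1 - \<gamma> + \<kappa>\<^sup>2 * \<xi> t) \<longrightarrow>
     (\<Sum>t<T. \<epsilon> t * (\<Sum>i=t+1..T.
        nu CARD('x) CARD('h) \<kappa> \<gamma> (spectral_norm B) Mb xb W \<theta> G \<xi> i))
       < mu_tilde CARD('h) T \<kappa> \<gamma> \<mu> \<sigma> \<longrightarrow>
     (\<forall>t<T. \<epsilon> t < \<phi> * (real T - real CARD('h) + 1) * mu_bar \<kappa> \<gamma> \<mu> \<sigma> / (\<zeta> ^ (T - t) - 1))"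
proof -
  define b where "b = spectral_norm B"
  define C where "C = const1 CARD('x) CARD('h) \<kappa> \<gamma> b W \<theta> * const3 CARD('h) b Mb W"
  define \<phi> where "\<phi> = (if 0 < C then \<zeta> / C else 1)"
  have b: "0 \<le> b"
    unfolding b_def by (rule spectral_norm_nonneg)
  show ?thesis
  proof (intro exI[of _ \<phi>] conjI allI impI)
    show "0 < \<phi>"
      using \<open>\<zeta> > 1\<close> by (simp add: \<phi>_def)
  next
    fix \<Omega> :: "'w measure" and T \<sigma> \<mu> \<xi> \<epsilon> D c Pol w \<Delta> X U t
    assume pc: "performative_control \<Omega> A B K \<kappa> \<gamma> Pols Mb xb W \<theta> G T \<sigma> \<mu> \<xi> \<epsilon> D c Pol w \<Delta> X U"
      and ae: "AE \<omega> in \<Omega>. \<forall>t<T. \<zeta> \<le> spectral_norm (A + \<Delta> t \<omega>) \<and>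
        spectral_norm (A + \<Delta> t \<omega>) \<le> 1 - \<gamma> + \<kappa>\<^sup>2 * \<xi> t"
      and cond: "(\<Sum>t<T. \<epsilon> t * (\<Sum>i=t+1..T.
        nu CARD('x) CARD('h) \<kappa> \<gamma> (spectral_norm B) Mb xb W \<theta> G \<xi> i))
        < mu_tilde CARD('h) T \<kappa> \<gamma> \<mu> \<sigma>"
      and t: "t < T"
    interpret performative_control \<Omega> A B K \<kappa> \<gamma> Pols Mb xb W \<theta> G T \<sigma> \<mu> \<xi> \<epsilon> D c Pol w \<Delta> X U
      by (rule pc)
    let ?nu = "nu CARD('x) CARD('h) \<kappa> \<gamma> b Mb xb W \<theta> G \<xi>"
    let ?R = "(real T - real CARD('h) + 1) * mu_bar \<kappa> \<gamma> \<mu> \<sigma>"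
    have \<kappa>: "1 \<le> \<kappa>" and \<gamma>: "\<gamma> < 1"
      using stabilizing by (auto simp: strongly_stabilizing_def)
    have unst: "\<zeta> \<le> 1 - \<gamma> + \<kappa>\<^sup>2 * \<xi> j" if "j < T" for j
      using eventually_happens'[OF ae_filter_bot ae] that by (auto intro: order_trans)
    have c1: "0 \<le> const1 CARD('x) CARD('h) \<kappa> \<gamma> b W \<theta>"
      using \<kappa> \<gamma> b smoothness_pos noise_bound_nonneg by (simp add: const1_def)
    have c2: "0 \<le> const2 CARD('x) CARD('h) \<kappa> \<gamma> b W G"
      using \<kappa> \<gamma> b G_pos noise_bound_nonneg by (simp add: const2_def)
    have c3: "0 \<le> const3 CARD('h) b Mb W"
      using b policy_bound_nonneg noise_bound_nonneg by (simp add: const3_def)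
    have nu_ge: "C * \<zeta> ^ (i - 1) \<le> ?nu i" if "i \<le> T" "0 < i" for i
      unfolding C_def
      using c1 c2 c3 initial_bound_nonneg \<open>\<zeta> > 1\<close> unst that by (intro const_mult_power_le_nu) auto
    have "0 \<le> C"
      using c1 c3 by (simp add: C_def)
    have nu_nonneg: "0 \<le> ?nu i" if "i \<in> {s+1..T}" for i s
    proof -
      have "0 \<le> C * \<zeta> ^ (i - 1)"
        using \<open>0 \<le> C\<close> \<open>\<zeta> > 1\<close> by simp
      also have "\<dots> \<le> ?nu i"
        using that by (intro nu_ge) auto
      finally show ?thesis .
    qed
    have term_nonneg: "0 \<le> \<epsilon> s * (\<Sum>i=s+1..T. ?nu i)" if "s < T" for s
      using sensitivity_pos[OF that] nu_nonneg by (intro mult_nonneg_nonneg sum_nonneg) auto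
    have cond': "(\<Sum>s<T. \<epsilon> s * (\<Sum>i=s+1..T. ?nu i)) < ?R"
      using cond horizon by (simp add: b_def mu_tilde_eq)
    have "\<sigma> \<noteq> 0"
    proof
      assume "\<sigma> = 0"
      with cond' have "(\<Sum>s<T. \<epsilon> s * (\<Sum>i=s+1..T. ?nu i)) < 0"
        by (simp add: mu_bar_def)
      moreover have "0 \<le> (\<Sum>s<T. \<epsilon> s * (\<Sum>i=s+1..T. ?nu i))"
        using term_nonneg by (intro sum_nonneg) auto
      ultimately show False
        by simp
    qed
    then have "0 < W"
      by (rule noise_bound_pos)
    have "0 < C"
    proof -
      have "0 < \<kappa>^2 + \<kappa>^3"
        using \<kappa> by (intro add_pos_pos) auto
      then have "0 < 1 + (\<kappa>^2 + \<kappa>^3) * b"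
        using b by (simp add: add_pos_nonneg)
      then have "0 < const1 CARD('x) CARD('h) \<kappa> \<gamma> b W \<theta>"
        using \<open>0 < W\<close> \<open>0 < \<kappa>^2 + \<kappa>^3\<close> \<gamma> smoothness_pos by (simp add: const1_def)
      moreover have "0 < const3 CARD('h) b Mb W"
        using \<open>0 < W\<close> b policy_bound_nonneg by (simp add: const3_def add_nonneg_pos)
      ultimately show ?thesis
        by (simp add: C_def)
    qed
    have gap: "0 < \<zeta> ^ (T - t) - 1"
      using \<open>\<zeta> > 1\<close> t by simp
    (* of the inner sum over i only the last term, i = T, is used *)
    have "\<zeta> ^ (T - t) - 1 \<le> \<zeta> ^ T"
      using power_increasing[of "T - t" T \<zeta>] \<open>\<zeta> > 1\<close> by (simp del: power_increasing_iff)
    also have "\<dots> = \<zeta> * \<zeta> ^ (T - 1)"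
      using t by (cases T) auto
    also have "\<dots> = \<phi> * (C * \<zeta> ^ (T - 1))"
      using \<open>0 < C\<close> by (simp add: \<phi>_def)
    also have "\<dots> \<le> \<phi> * ?nu T"
      using \<open>0 < C\<close> \<open>\<zeta> > 1\<close> t by (intro mult_left_mono nu_ge) (auto simp: \<phi>_def)
    also have "\<dots> \<le> \<phi> * (\<Sum>i=t+1..T. ?nu i)"
      using \<open>0 < C\<close> \<open>\<zeta> > 1\<close> t nu_nonneg
      by (intro mult_left_mono member_le_sum) (auto simp: \<phi>_def)
    finally have "\<epsilon> t * (\<zeta> ^ (T - t) - 1) \<le> \<epsilon> t * (\<phi> * (\<Sum>i=t+1..T. ?nu i))"
      using sensitivity_pos[OF t] by (intro mult_left_mono) auto
    also have "\<dots> = \<phi> * (\<epsilon> t * (\<Sum>i=t+1..T. ?nu i))"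
      by (simp add: mult.left_commute)
    also have "\<dots> \<le> \<phi> * (\<Sum>s<T. \<epsilon> s * (\<Sum>i=s+1..T. ?nu i))"
      using \<open>0 < C\<close> \<open>\<zeta> > 1\<close> t term_nonneg
      by (intro mult_left_mono member_le_sum[where f = "\<lambda>s. \<epsilon> s * (\<Sum>i=s+1..T. ?nu i)"])
         (auto simp: \<phi>_def)
    also have "\<dots> < \<phi> * ?R"
      using cond' \<open>0 < C\<close> \<open>\<zeta> > 1\<close> by (simp add: \<phi>_def divide_strict_right_mono)
    finally show "\<epsilon> t < \<phi> * (real T - real CARD('h) + 1) * mu_bar \<kappa> \<gamma> \<mu> \<sigma> / (\<zeta> ^ (T - t) - 1)"
      using gap by (simp add: pos_less_divide_eq mult.assoc)
  qed
qed

end
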